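(* Let $\mathcal{H}$ be a nonzero complex Hilbert space, $n\ge 1$, and let $A=[a_{ij}]\in\mathcal{M}_n(\mathbb{C})$ and $B\in\mathcal{B}(\mathcal{H})$ be arbitrary. Then $$w(A)w(B)\le w(A\otimes B)\le \|A\|\,w(B)\le\left(\max_{1\le i\le n}\sum_{j=1}^n|a_{ij}|\right)^{1/2}\left(\max_{1\le j\le n}\sum_{i=1}^n|a_{ij}|\right)^{1/2}w(B).$$ Moreover, for every $1\le p\le\infty$, with $q$ defined by $\frac1p+\frac1q=1$, $$\min_{1\le i\le n}\left|\sum_{j=1}^n a_{ij}\right|\,\|B\|\le\|A\otimes B\|_p\le\left(\max_{1\le i\le n}\sum_{j=1}^n|a_{ij}|\right)^{1/q}\left(\max_{1\le j\le n}\sum_{i=1}^n|a_{ij}|\right)^{1/p}\|B\|.$$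
   Context: $\mathcal{B}(\mathcal{H})$ denotes the bounded linear operators on $\mathcal{H}$; $\|\cdot\|$ is the operator norm (for $A\in\mathcal{M}_n(\mathbb{C})$, the spectral norm on Euclidean $\mathbb{C}^n$). The numerical radius of a bounded operator $T$ on a complex Hilbert space $\mathcal{K}$ is $w(T)=\sup\{|\langle Tx,x\rangle| : x\in\mathcal{K},\ \|x\|=1\}$. The Kronecker product $A\otimes B=[a_{ij}B]_{i,j=1}^n$ is the operator matrix acting on $\mathcal{H}^n=\mathcal{H}^{\oplus n}$. For $1\le p\le\infty$, the $\ell_p$ operator norm is $$\|A\otimes B\|_p=\sup\left\{\frac{\|(A\otimes B)x\|_p}{\|x\|_p} : x\in\mathcal{H}^n,\ x\ne 0\right\},$$ where $\|x\|_p=\left(\sum_{j=1}^n\|x_j\|^p\right)^{1/p}$ for $x=(x_1,\dots,x_n)^T\in\mathcal{H}^n$ (and $\|x\|_\infty=\max_j\|x_j\|$). The usual convention $1/\infty=0$ is used, with zeroth powers of the displayed maxima read as $1$. *)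

theory Defs
  imports "HOL-Analysis.Analysis"
begin

(* Inner products are linear in the first argument.  Non-negativity and definiteness of
   cinner follow from the norm axiom, since the norm is non-negative and definite. *)
class complex_inner = real_normed_vector +
  fixes scaleC :: "complex \<Rightarrow> 'a \<Rightarrow> 'a" (infixr "*\<^sub>C" 75)
    and cinner :: "'a \<Rightarrow> 'a \<Rightarrow> complex"
  assumes scaleC_add_right: "c *\<^sub>C (x + y) = c *\<^sub>C x + c *\<^sub>C y"
    and scaleC_add_left: "(c + d) *\<^sub>C x = c *\<^sub>C x + d *\<^sub>C x"
    and scaleC_scaleC: "c *\<^sub>C d *\<^sub>C x = (c * d) *\<^sub>C x"
    and scaleC_one: "1 *\<^sub>C x = x"
    and scaleR_scaleC: "r *\<^sub>R x = complex_of_real r *\<^sub>C x"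
    and cinner_commute: "cinner x y = cnj (cinner y x)"
    and cinner_add_left: "cinner (x + y) z = cinner x z + cinner y z"
    and cinner_scaleC_left: "cinner (c *\<^sub>C x) y = c * cinner x y"
    and norm_eq_sqrt_cinner: "norm x = sqrt (Re (cinner x x))"

class chilbert_space = complex_inner + complete_space

instantiation complex :: chilbert_space
begin

definition scaleC_complex :: "complex \<Rightarrow> complex \<Rightarrow> complex" where
  "scaleC_complex c x = c * x"

definition cinner_complex :: "complex \<Rightarrow> complex \<Rightarrow> complex" where
  "cinner_complex x y = x * cnj y"

instance
  by standard
    (simp_all add: scaleC_complex_def cinner_complex_def algebra_simps scaleR_conv_of_real
      cmod_def power2_eq_square)

end

(* The inherited norm on 'a ^ 'n is the Euclidean one, so this is the Hilbert direct sum. *)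
instantiation vec :: (complex_inner, finite) complex_inner
begin

definition scaleC_vec :: "complex \<Rightarrow> 'a ^ 'b \<Rightarrow> 'a ^ 'b" where
  "scaleC_vec c x = (\<chi> i. c *\<^sub>C (x $ i))"

definition cinner_vec :: "'a ^ 'b \<Rightarrow> 'a ^ 'b \<Rightarrow> complex" where
  "cinner_vec x y = (\<Sum>i\<in>UNIV. cinner (x $ i) (y $ i))"

instance
proof
  fix x y z :: "'a ^ 'b" and c d :: complex and r :: real
  show "c *\<^sub>C (x + y) = c *\<^sub>C x + c *\<^sub>C y"
    by (simp add: scaleC_vec_def vec_eq_iff scaleC_add_right)
  show "(c + d) *\<^sub>C x = c *\<^sub>C x + d *\<^sub>C x"
    by (simp add: scaleC_vec_def vec_eq_iff scaleC_add_left)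
  show "c *\<^sub>C d *\<^sub>C x = (c * d) *\<^sub>C x"
    by (simp add: scaleC_vec_def vec_eq_iff scaleC_scaleC)
  show "1 *\<^sub>C x = x"
    by (simp add: scaleC_vec_def vec_eq_iff scaleC_one)
  show "r *\<^sub>R x = complex_of_real r *\<^sub>C x"
    by (simp add: scaleC_vec_def vec_eq_iff scaleR_scaleC)
  show "cinner x y = cnj (cinner y x)"
    unfolding cinner_vec_def cnj_sum by (rule sum.cong [OF refl]) (rule cinner_commute)
  show "cinner (x + y) z = cinner x z + cinner y z"
    by (simp add: cinner_vec_def cinner_add_left sum.distrib)
  show "cinner (c *\<^sub>C x) y = c * cinner x y"
    by (simp add: cinner_vec_def scaleC_vec_def cinner_scaleC_left sum_distrib_left)
  have "(norm (x $ i))\<^sup>2 = Re (cinner (x $ i) (x $ i))" for i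
  proof -
    have "0 \<le> Re (cinner (x $ i) (x $ i))"
      using norm_ge_zero [of "x $ i"] by (simp add: norm_eq_sqrt_cinner)
    then show ?thesis
      by (simp add: norm_eq_sqrt_cinner)
  qed
  then show "norm x = sqrt (Re (cinner x x))"
    by (simp add: norm_vec_def L2_set_def cinner_vec_def)
qed

end

instance vec :: (chilbert_space, finite) chilbert_space ..

definition bounded_clinear :: "('a::complex_inner \<Rightarrow> 'b::complex_inner) \<Rightarrow> bool" where
  "bounded_clinear T \<longleftrightarrow> bounded_linear T \<and> (\<forall>c x. T (c *\<^sub>C x) = c *\<^sub>C T x)"

(* Meaningful for bounded operators on nonzero spaces; Sup of an empty or unbounded set of reals
   is unspecified. *)
definition numerical_radius :: "('a::complex_inner \<Rightarrow> 'a) \<Rightarrow> real" where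
  "numerical_radius T = (SUP x\<in>{x. norm x = 1}. cmod (cinner (T x) x))"

(* The operator matrix [a_ij B] as an operator on the n-fold direct sum. *)
definition kronecker :: "complex ^ 'n::finite ^ 'n \<Rightarrow> ('h::complex_inner \<Rightarrow> 'h) \<Rightarrow> 'h ^ 'n \<Rightarrow> 'h ^ 'n"
    (infixl "\<otimes>\<^sub>K" 70) where
  "(A \<otimes>\<^sub>K B) x = (\<chi> i. \<Sum>j\<in>UNIV. (A $ i $ j) *\<^sub>C B (x $ j))"

definition lp_norm :: "ennreal \<Rightarrow> 'h::real_normed_vector ^ 'n::finite \<Rightarrow> real" where
  "lp_norm p x =
    (if p = top then MAX j. norm (x $ j)
     else (\<Sum>j\<in>UNIV. norm (x $ j) powr enn2real p) powr (1 / enn2real p))"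

definition lp_opnorm :: "ennreal \<Rightarrow> ('h::real_normed_vector ^ 'n::finite \<Rightarrow> 'h ^ 'n) \<Rightarrow> real" where
  "lp_opnorm p T = (SUP x\<in>{x. x \<noteq> 0}. lp_norm p (T x) / lp_norm p x)"

(* Real power with 0 to the power 0 equal to 1, in contrast to 0 powr 0 = 0. *)
definition rpow :: "real \<Rightarrow> real \<Rightarrow> real" where
  "rpow x a = (if a = 0 then 1 else x powr a)"

end

theory Submission
  imports Defs
begin

text \<open>
  The deep inequality is \<open>w(A \<otimes> B) \<le> \<parallel>A\<parallel> w(B)\<close>; it is a power dilation argument carried out with finite
  sums.  By homogeneity \<open>A\<close> may be taken to be a contraction.  Then \<open>I - A\<^sup>*A\<close> is positive
  semidefinite, hence \<open>E\<^sup>*E\<close> for some matrix \<open>E\<close> (\<open>contraction_complement\<close>).  Write \<open>T = A \<otimes> I\<close>,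
  \<open>S = E \<otimes> I\<close>, \<open>D = I \<otimes> B\<close>; these satisfy \<open>T\<^sup>*T + S\<^sup>*S = I\<close>, and \<open>D\<close> commutes with \<open>T\<close> and \<open>S\<close>.
  If \<open>T\<^sup>k x\<close> tends to \<open>0\<close>, then \<open>x \<mapsto> (S T\<^sup>k x)\<^sub>k\<close> is an isometry into the square-summable sequences
  that turns \<open>T\<close> into the backward shift.  In general the part of the norm that stays in \<open>T\<^sup>k x\<close> has
  to be carried along.

  This reduces the claim to backward shifts, that is, to a bound on \<open>\<Sum>\<^sub>k \<langle>D \<xi>\<^sub>k\<^sub>+\<^sub>1, \<xi>\<^sub>k\<rangle>\<close> by
  \<open>w(B) \<Sum>\<^sub>k \<parallel>\<xi>\<^sub>k\<parallel>\<^sup>2\<close> (\<open>shift_numerical_bound\<close>).  A finite Fourier transform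
  diagonalises the cyclic shift that extends the finite backward shift: the vectors \<open>\<Sum>\<^sub>k z\<^sup>-\<^sup>k \<xi>\<^sub>k\<close>, for \<open>z\<close> in a group of roots of unity, decouple the sum into numerical values
  of \<open>D\<close> with unimodular weights.

  The lower bound \<open>w(A) w(B) \<le> w(A \<otimes> B)\<close> comes from testing elementary tensors, for which
  the quadratic form factors (\<open>cinner_kronecker_elementary\<close>).

  The \<open>\<ell>\<^sub>p\<close> upper bound is the Schur test: Jensen's inequality, with the entries of a row as weights,
  followed by an exchange of the summations (\<open>Schur_test_sum\<close>).  Its case \<open>p = 2\<close> bounds the spectral norm
  of \<open>A\<close>.  The \<open>\<ell>\<^sub>p\<close> lower bound comes from testing vectors with all components equal, on which
  \<open>A \<otimes> B\<close> acts by the row sums of \<open>A\<close>.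
\<close>

section \<open>Complex inner product spaces\<close>

lemma cinner_zero_left [simp]: "cinner 0 (y::'a::complex_inner) = 0"
  using cinner_add_left [of 0 0 y] by simp

lemma cinner_zero_right [simp]: "cinner x (0::'a::complex_inner) = 0"
  by (subst cinner_commute) simp

lemma cinner_add_right: "cinner x (y + z :: 'a::complex_inner) = cinner x y + cinner x z"
  by (metis cinner_commute cinner_add_left complex_cnj_add)

lemma cinner_scaleC_right: "cinner x (c *\<^sub>C y :: 'a::complex_inner) = cnj c * cinner x y"
  by (metis cinner_commute cinner_scaleC_left complex_cnj_mult)

lemma cinner_sum_left:
  "cinner (\<Sum>i\<in>S. f i) (y::'a::complex_inner) = (\<Sum>i\<in>S. cinner (f i) y)"
  by (induction S rule: infinite_finite_induct) (simp_all add: cinner_add_left)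

lemma cinner_sum_right:
  "cinner x (\<Sum>i\<in>S. f i :: 'a::complex_inner) = (\<Sum>i\<in>S. cinner x (f i))"
  by (induction S rule: infinite_finite_induct) (simp_all add: cinner_add_right)

lemma cinner_self: "cinner x x = complex_of_real ((norm (x::'a::complex_inner))\<^sup>2)"
proof -
  have "Im (cinner x x) = 0"
    using arg_cong [OF cinner_commute [of x x], of Im] by simp
  moreover have "0 \<le> Re (cinner x x)"
    using norm_ge_zero [of x] by (simp add: norm_eq_sqrt_cinner)
  ultimately show ?thesis
    by (simp add: complex_eq_iff norm_eq_sqrt_cinner [of x])
qed

lemma scaleC_sum_right:
  "c *\<^sub>C (\<Sum>i\<in>S. f i) = (\<Sum>i\<in>S. c *\<^sub>C (f i :: 'a::complex_inner))"
proof -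
  interpret additive "\<lambda>x::'a. c *\<^sub>C x"
    by standard (rule scaleC_add_right)
  show ?thesis
    by (rule sum)
qed

lemma scaleC_sum_left:
  "(\<Sum>i\<in>S. f i) *\<^sub>C x = (\<Sum>i\<in>S. f i *\<^sub>C (x :: 'a::complex_inner))"
proof -
  interpret additive "\<lambda>c. c *\<^sub>C x"
    by standard (rule scaleC_add_left)
  show ?thesis
    by (rule sum)
qed

lemma norm_scaleC: "norm (c *\<^sub>C (x::'a::complex_inner)) = cmod c * norm x"
proof -
  have "cinner (c *\<^sub>C x) (c *\<^sub>C x) = complex_of_real ((cmod c * norm x)\<^sup>2)"
    unfolding cinner_scaleC_left cinner_scaleC_right cinner_self [of x]
    using complex_norm_square [of c] by (simp add: power_mult_distrib)
  then have "(norm (c *\<^sub>C x))\<^sup>2 = (cmod c * norm x)\<^sup>2"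
    unfolding cinner_self of_real_eq_iff .
  then show ?thesis
    by simp
qed

lemma norm_sum_scaleC_le:
  "norm (\<Sum>j\<in>S. c j *\<^sub>C (x j :: 'a::complex_inner)) \<le> (\<Sum>j\<in>S. cmod (c j) * norm (x j))"
  by (rule order_trans [OF norm_sum]) (simp add: norm_scaleC)

lemma Cauchy_Schwarz_cinner: "cmod (cinner x y) \<le> norm x * norm (y::'a::complex_inner)"
proof (cases "y = 0")
  case False
  define s where "s = cinner x y"
  define d where "d = complex_of_real ((norm y)\<^sup>2)"
  have d: "cnj d = d" "d \<noteq> 0" "cinner y y = d"
    using False by (simp_all add: d_def cinner_self)
  define c where "c = - s / d"
  have "complex_of_real ((norm (x + c *\<^sub>C y))\<^sup>2)
      = cinner x x + c * cnj s + cnj c * s + c * cnj c * cinner y y"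
    unfolding cinner_self [symmetric]
    by (simp add: cinner_add_left cinner_add_right cinner_scaleC_left
        cinner_scaleC_right s_def cinner_commute [of y x] algebra_simps)
  also have "\<dots> = of_real ((norm x)\<^sup>2) - s * cnj s / d"
    using d by (simp add: c_def cinner_self field_simps)
  also have "\<dots> = of_real ((norm x)\<^sup>2 - (cmod s)\<^sup>2 / (norm y)\<^sup>2)"
    using complex_norm_square [of s] by (simp add: d_def)
  finally have "(norm (x + c *\<^sub>C y))\<^sup>2 = (norm x)\<^sup>2 - (cmod s)\<^sup>2 / (norm y)\<^sup>2"
    unfolding of_real_eq_iff .
  then have "0 \<le> (norm x)\<^sup>2 - (cmod s)\<^sup>2 / (norm y)\<^sup>2"
    by (metis zero_le_power2)
  with False have "(cmod s)\<^sup>2 \<le> (norm x * norm y)\<^sup>2"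
    by (simp add: divide_simps power_mult_distrib split: if_splits)
  then show ?thesis
    unfolding s_def by (rule power2_le_imp_le) simp
qed simp

section \<open>Numerical radius\<close>

lemma bounded_clinear_scaleC: "bounded_clinear B \<Longrightarrow> B (c *\<^sub>C x) = c *\<^sub>C B x"
  by (simp add: bounded_clinear_def)

lemma bounded_clinear_add: "bounded_clinear B \<Longrightarrow> B (x + y) = B x + B y"
  by (simp add: bounded_clinear_def linear_add bounded_linear.linear)

lemma bounded_clinear_sum: "bounded_clinear B \<Longrightarrow> B (\<Sum>i\<in>S. f i) = (\<Sum>i\<in>S. B (f i))"
  by (simp add: bounded_clinear_def linear_sum bounded_linear.linear)

lemma norm_le_onorm_if_bounded_clinear: "bounded_clinear B \<Longrightarrow> norm (B x) \<le> onorm B * norm x"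
  by (simp add: bounded_clinear_def onorm)

lemma exists_norm_one: "\<exists>x::'a::real_normed_vector. x \<noteq> 0 \<Longrightarrow> \<exists>y::'a. norm y = 1"
  by (auto intro: exI [where x = "sgn x" for x] simp: norm_sgn)

lemma numerical_radius_least:
  assumes "\<exists>x::'a::complex_inner. x \<noteq> 0"
    and "\<And>x::'a. norm x = 1 \<Longrightarrow> cmod (cinner (T x) x) \<le> w"
  shows "numerical_radius T \<le> w"
  unfolding numerical_radius_def
  using exists_norm_one [OF assms(1)] by (intro cSUP_least) (auto intro: assms(2))

text \<open>
  A supremum of reals bounds its members only if the set is bounded; the estimate \<open>w\<close>, which need
  not be sharp, provides this.
\<close>
lemma numerical_radius_upper:
  assumes "\<And>x::'a::complex_inner. cmod (cinner (T x) x) \<le> w * (norm x)\<^sup>2" and "norm x = 1"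
  shows "cmod (cinner (T x) x) \<le> numerical_radius T"
  unfolding numerical_radius_def
proof (rule cSUP_upper)
  show "bdd_above ((\<lambda>x. cmod (cinner (T x) x)) ` {x. norm x = 1})"
  proof (rule bdd_aboveI2)
    show "cmod (cinner (T y) y) \<le> w" if "y \<in> {x. norm x = 1}" for y
      using assms(1) [of y] that by simp
  qed
qed (use assms(2) in simp)

lemma cinner_le_numerical_radius:
  assumes "bounded_clinear B"
  shows "cmod (cinner (B x) x) \<le> numerical_radius B * (norm (x::'a::complex_inner))\<^sup>2"
proof (cases "x = 0")
  case True
  then show ?thesis by simp
next
  case False
  define u where "u = sgn x"
  have x: "x = complex_of_real (norm x) *\<^sub>C u"
    using False by (simp add: u_def sgn_div_norm scaleR_scaleC [symmetric])
  have bound: "cmod (cinner (B v) v) \<le> onorm B * (norm v)\<^sup>2" for v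
    by (rule order_trans [OF Cauchy_Schwarz_cinner])
      (simp add: power2_eq_square mult.assoc [symmetric] mult_right_mono
        norm_le_onorm_if_bounded_clinear [OF assms])
  have "cmod (cinner (B u) u) \<le> numerical_radius B"
    by (rule numerical_radius_upper [OF bound]) (use False in \<open>simp add: u_def norm_sgn\<close>)
  moreover have "cinner (B x) x = of_real ((norm x)\<^sup>2) * cinner (B u) u"
    by (subst (1 2) x)
      (simp add: bounded_clinear_scaleC [OF assms] cinner_scaleC_left cinner_scaleC_right
        power2_eq_square)
  ultimately show ?thesis
    by (simp add: norm_mult norm_power mult.commute mult_right_mono)
qed

lemma numerical_radius_nonneg:
  assumes "\<exists>x::'a::complex_inner. x \<noteq> 0" and "bounded_clinear (B :: 'a \<Rightarrow> 'a)"
  shows "0 \<le> numerical_radius B"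
proof -
  obtain u :: 'a where "norm u = 1"
    using assms(1) exists_norm_one by blast
  then show ?thesis
    using order_trans [OF norm_ge_zero cinner_le_numerical_radius [OF assms(2), of u]] by simp
qed

section \<open>The numerical radius of a shift\<close>

lemma roots_of_unity_orthogonal:
  fixes M :: nat
  assumes "a < M" "b < M"
  defines "z \<equiv> \<lambda>j. cis (2 * pi * real j / real M)"
  shows "(\<Sum>j<M. z j ^ a * cnj (z j) ^ b) = (if a = b then of_nat M else 0)"
proof -
  define r where "r = z a * cnj (z b)"
  have *: "z j ^ a * cnj (z j) ^ b = r ^ j" for j
    by (simp add: r_def z_def cis_cnj power_mult_distrib Complex.DeMoivre cis_mult field_simps)
  have [simp]: "cnj (z b) = inverse (z b)" "z b \<noteq> 0"
    by (simp_all add: z_def cis_cnj)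
  have "z j ^ M = 1" for j
    using assms by (simp add: z_def Complex.DeMoivre cis_multiple_2pi)
  then have "r ^ M = 1"
    by (simp add: r_def power_mult_distrib power_inverse)
  moreover have "r = 1 \<longleftrightarrow> a = b"
  proof
    assume "r = 1"
    then have "z a = z b"
      by (simp add: r_def field_simps)
    moreover have "inj_on z {..<M}"
      unfolding z_def
      by (rule bij_betw_imp_inj_on [OF Complex.bij_betw_roots_unity]) (use assms(1) in simp)
    ultimately show "a = b"
      using assms(1,2) by (auto dest: inj_onD)
  qed (simp add: r_def)
  ultimately show ?thesis
    unfolding * by (cases "a = b") (simp_all add: geometric_sum)
qed

text \<open>
  Let \<open>S z = \<Sum>\<^sub>k z\<^sup>-\<^sup>k \<xi>\<^sub>k\<close> for a root of unity \<open>z\<close>.  Averaged over all \<open>z\<close>, the values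
  \<open>z \<langle>C (S z), S z\<rangle>\<close> retain exactly the terms \<open>\<langle>C \<xi>\<^sub>l\<^sub>+\<^sub>1, \<xi>\<^sub>l\<rangle>\<close>, while the squared norms of \<open>S z\<close>
  average to \<open>\<Sum>\<^sub>k \<parallel>\<xi>\<^sub>k\<parallel>\<^sup>2\<close> by Parseval.  Since \<open>|z| = 1\<close>, the hypothesis on \<open>C\<close> bounds the former by
  the latter.
\<close>
lemma shift_numerical_bound:
  fixes C :: "'a::complex_inner \<Rightarrow> 'a" and \<xi> :: "nat \<Rightarrow> 'a"
  assumes add: "\<And>x y. C (x + y) = C x + C y"
    and scale: "\<And>c x. C (c *\<^sub>C x) = c *\<^sub>C C x"
    and bound: "\<And>x. cmod (cinner (C x) x) \<le> w * (norm x)\<^sup>2"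
  shows "cmod (\<Sum>k<N. cinner (C (\<xi> (Suc k))) (\<xi> k)) \<le> w * (\<Sum>k\<le>N. (norm (\<xi> k))\<^sup>2)"
proof -
  interpret C: additive C
    by standard (rule add)
  \<comment> \<open>The exponents \<open>0, \<dots>, N + 1\<close> occur and must stay distinct modulo \<open>M\<close>.\<close>
  define M where "M = N + 2"
  define z where "z = (\<lambda>j. cis (2 * pi * real j / real M))"
  define S where "S = (\<lambda>j. \<Sum>k\<le>N. cnj (z j) ^ k *\<^sub>C \<xi> k)"
  have orth: "(\<Sum>j<M. z j ^ a * cnj (z j) ^ b) = (if a = b then of_nat M else 0)"
    if "a < M" "b < M" for a b
    unfolding z_def using that by (rule roots_of_unity_orthogonal)
  have CS: "cinner (C (S j)) (S j)
      = (\<Sum>k\<le>N. \<Sum>l\<le>N. z j ^ l * cnj (z j) ^ k * cinner (C (\<xi> k)) (\<xi> l))" for j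
    by (subst sum.swap) (simp add: S_def C.sum scale cinner_sum_left cinner_sum_right cinner_scaleC_left
        cinner_scaleC_right mult_ac sum_distrib_left)
  have SS: "cinner (S j) (S j)
      = (\<Sum>k\<le>N. \<Sum>l\<le>N. z j ^ l * cnj (z j) ^ k * cinner (\<xi> k) (\<xi> l))" for j
    by (subst sum.swap) (simp add: S_def cinner_sum_left cinner_sum_right cinner_scaleC_left
        cinner_scaleC_right mult_ac sum_distrib_left)
  have "(\<Sum>j<M. z j * cinner (C (S j)) (S j))
      = (\<Sum>j<M. \<Sum>k\<le>N. \<Sum>l\<le>N. z j ^ Suc l * cnj (z j) ^ k * cinner (C (\<xi> k)) (\<xi> l))"
    by (simp add: CS sum_distrib_left mult_ac)
  also have "\<dots> = (\<Sum>k\<le>N. \<Sum>j<M. \<Sum>l\<le>N. z j ^ Suc l * cnj (z j) ^ k * cinner (C (\<xi> k)) (\<xi> l))"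
    by (rule sum.swap)
  also have "\<dots> = (\<Sum>k\<le>N. \<Sum>l\<le>N. \<Sum>j<M. z j ^ Suc l * cnj (z j) ^ k * cinner (C (\<xi> k)) (\<xi> l))"
    by (intro sum.cong refl sum.swap)
  also have "\<dots> = (\<Sum>k\<le>N. \<Sum>l\<le>N. (if k = Suc l then of_nat M else 0) * cinner (C (\<xi> k)) (\<xi> l))"
    by (intro sum.cong refl, subst sum_distrib_right [symmetric], subst orth)
      (auto simp: M_def)
  also have "\<dots> = (\<Sum>l\<le>N. \<Sum>k\<le>N. if k = Suc l then of_nat M * cinner (C (\<xi> k)) (\<xi> l) else 0)"
    by (subst sum.swap) (intro sum.cong refl, simp)
  also have "\<dots> = (\<Sum>l\<le>N. if Suc l \<le> N then of_nat M * cinner (C (\<xi> (Suc l))) (\<xi> l) else 0)"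
    by (simp add: sum.delta)
  also have "\<dots> = (\<Sum>l<N. of_nat M * cinner (C (\<xi> (Suc l))) (\<xi> l))"
    by (rule sum.mono_neutral_cong_right) auto
  finally have lhs: "(\<Sum>j<M. z j * cinner (C (S j)) (S j))
      = of_nat M * (\<Sum>k<N. cinner (C (\<xi> (Suc k))) (\<xi> k))"
    by (simp add: sum_distrib_left)
  have "(\<Sum>j<M. cinner (S j) (S j))
      = (\<Sum>k\<le>N. \<Sum>j<M. \<Sum>l\<le>N. z j ^ l * cnj (z j) ^ k * cinner (\<xi> k) (\<xi> l))"
    unfolding SS by (rule sum.swap)
  also have "\<dots> = (\<Sum>k\<le>N. \<Sum>l\<le>N. \<Sum>j<M. z j ^ l * cnj (z j) ^ k * cinner (\<xi> k) (\<xi> l))"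
    by (intro sum.cong refl sum.swap)
  also have "\<dots> = (\<Sum>k\<le>N. \<Sum>l\<le>N. (if l = k then of_nat M else 0) * cinner (\<xi> k) (\<xi> l))"
    by (intro sum.cong refl, subst sum_distrib_right [symmetric], subst orth)
      (auto simp: M_def)
  also have "\<dots> = (\<Sum>k\<le>N. \<Sum>l\<le>N. if l = k then of_nat M * cinner (\<xi> k) (\<xi> l) else 0)"
    by (intro sum.cong refl) simp
  also have "\<dots> = (\<Sum>k\<le>N. of_nat M * cinner (\<xi> k) (\<xi> k))"
    by simp
  also have "\<dots> = complex_of_real (real M * (\<Sum>k\<le>N. (norm (\<xi> k))\<^sup>2))"
    by (simp add: cinner_self sum_distrib_left)
  also have "(\<Sum>j<M. cinner (S j) (S j)) = complex_of_real (\<Sum>j<M. (norm (S j))\<^sup>2)"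
    by (simp add: cinner_self)
  finally have norms: "(\<Sum>j<M. (norm (S j))\<^sup>2) = real M * (\<Sum>k\<le>N. (norm (\<xi> k))\<^sup>2)"
    unfolding of_real_eq_iff .
  have "real M * cmod (\<Sum>k<N. cinner (C (\<xi> (Suc k))) (\<xi> k))
      = cmod (\<Sum>j<M. z j * cinner (C (S j)) (S j))"
    unfolding lhs by (simp add: norm_mult)
  also have "\<dots> \<le> (\<Sum>j<M. w * (norm (S j))\<^sup>2)"
    by (rule sum_norm_le) (simp add: norm_mult z_def bound)
  also have "\<dots> = real M * (w * (\<Sum>k\<le>N. (norm (\<xi> k))\<^sup>2))"
    by (simp add: sum_distrib_left [symmetric] norms)
  finally show ?thesis
    by (simp add: M_def)
qed

section \<open>Defect of a contraction\<close>

text \<open>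
  Cholesky factorisation, by induction on the index set: the Schur complement
  \<open>P i j - P i k P k j / P k k\<close> of a diagonal entry is again positive semidefinite, and the subtracted
  part has rank one.  If \<open>P k k = 0\<close>, then the whole row of \<open>k\<close> vanishes and the formulas remain valid
  with \<open>x / 0 = 0\<close>.
\<close>
lemma psd_gram:
  fixes P :: "'a \<Rightarrow> 'a \<Rightarrow> complex"
  assumes "finite I"
    and "\<And>i j. i \<in> I \<Longrightarrow> j \<in> I \<Longrightarrow> P j i = cnj (P i j)"
    and "\<And>c. 0 \<le> Re (\<Sum>i\<in>I. \<Sum>j\<in>I. cnj (c i) * P i j * c j)"
  shows "\<exists>E. \<forall>i\<in>I. \<forall>j\<in>I. P i j = (\<Sum>r\<in>I. cnj (E r i) * E r j)"
  using assms
proof (induction I arbitrary: P)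
  case empty
  then show ?case by simp
next
  case (insert k I)
  note herm = insert.prems(1) and psd = insert.prems(2)
  define d where "d = Re (P k k)"
  have Pkk: "P k k = of_real d"
    using herm [of k k] by (simp add: d_def complex_eq_iff)
  have split: "(\<Sum>i\<in>insert k I. \<Sum>j\<in>insert k I. cnj (c i) * P i j * c j)
      = cnj (c k) * of_real d * c k + cnj (c k) * (\<Sum>j\<in>I. P k j * c j)
        + cnj (\<Sum>j\<in>I. P k j * c j) * c k + (\<Sum>i\<in>I. \<Sum>j\<in>I. cnj (c i) * P i j * c j)" for c
  proof -
    have "(\<Sum>i\<in>I. cnj (c i) * P i k * c k) = cnj (\<Sum>j\<in>I. P k j * c j) * c k"
      unfolding cnj_sum sum_distrib_right
      by (rule sum.cong [OF refl]) (simp add: herm [of k])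
    then show ?thesis
      using insert.hyps by (simp add: sum.distrib Pkk sum_distrib_left mult.assoc)
  qed
  have d_nonneg: "0 \<le> d"
  proof -
    define c :: "'a \<Rightarrow> complex" where "c = (\<lambda>i. if i = k then 1 else 0)"
    have c: "c k = 1" "\<And>i. i \<in> I \<Longrightarrow> c i = 0"
      using insert.hyps by (auto simp: c_def)
    have "0 \<le> Re (\<Sum>i\<in>insert k I. \<Sum>j\<in>insert k I. cnj (c i) * P i j * c j)"
      by (rule psd)
    also have "(\<Sum>i\<in>insert k I. \<Sum>j\<in>insert k I. cnj (c i) * P i j * c j) = of_real d"
      unfolding split by (simp add: c cong: sum.cong)
    finally show ?thesis by simp
  qed
  have row_zero: "P k j = 0" if "d = 0" "j \<in> I" for j
  proof (rule ccontr)
    assume nz: "P k j \<noteq> 0"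
    \<comment> \<open>With \<open>c j = 1\<close> and \<open>c k = - t P k j\<close> the form has value \<open>P j j - 2 t |P k j|\<^sup>2\<close>, because its
      \<open>|c k|\<^sup>2\<close> term is absent; this \<open>t\<close> turns it into \<open>- P j j - 2\<close>, which is negative as \<open>P j j \<ge> 0\<close>.\<close>
    define t where "t = (Re (P j j) + 1) / (cmod (P k j))\<^sup>2"
    define c where "c = (\<lambda>i. if i = k then - of_real t * P k j else if i = j then 1 else 0)"
    have jk: "j \<noteq> k"
      using that insert.hyps by auto
    have cI: "c i = (if i = j then 1 else 0)" if "i \<in> I" for i
      using that insert.hyps by (auto simp: c_def)
    have 1: "(\<Sum>i\<in>I. P k i * c i) = P k j"
    proof -
      have "(\<Sum>i\<in>I. P k i * c i) = (\<Sum>i\<in>I. if i = j then P k i else 0)"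
        by (rule sum.cong) (auto simp: cI)
      then show ?thesis
        using insert.hyps that by simp
    qed
    have 2: "(\<Sum>i\<in>I. \<Sum>l\<in>I. cnj (c i) * P i l * c l) = P j j"
    proof -
      have "(\<Sum>i\<in>I. \<Sum>l\<in>I. cnj (c i) * P i l * c l)
          = (\<Sum>i\<in>I. \<Sum>l\<in>I. if l = j then if i = j then P i l else 0 else 0)"
        by (intro sum.cong) (auto simp: cI)
      then show ?thesis
        using insert.hyps that by simp
    qed
    have "0 \<le> Re (\<Sum>i\<in>insert k I. \<Sum>l\<in>insert k I. cnj (c i) * P i l * c l)"
      by (rule psd)
    also have "\<dots> = Re (P j j) - 2 * t * (cmod (P k j))\<^sup>2"
      unfolding split 1 2 using that
      by (simp add: c_def cmod_def power2_eq_square algebra_simps)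
    also have "\<dots> = - Re (P j j) - 2"
      using nz by (simp add: t_def)
    finally have "Re (P j j) \<le> -2"
      by simp
    moreover have "0 \<le> Re (P j j)"
    proof -
      define c0 where "c0 = c(k := 0)"
      have "(\<Sum>i\<in>I. \<Sum>l\<in>I. cnj (c0 i) * P i l * c0 l) = P j j"
        unfolding 2 [symmetric] using insert.hyps by (intro sum.cong) (auto simp: c0_def)
      with psd [of c0] show ?thesis
        unfolding split by (simp only:) (simp add: c0_def)
    qed
    ultimately show False
      by simp
  qed
  define P' where "P' = (\<lambda>i j. P i j - P i k * P k j / of_real d)"
  have "\<exists>E. \<forall>i\<in>I. \<forall>j\<in>I. P' i j = (\<Sum>r\<in>I. cnj (E r i) * E r j)"
  proof (rule insert.IH)
    show "P' j i = cnj (P' i j)" if "i \<in> I" "j \<in> I" for i j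
      using that herm [of i j] herm [of i k] herm [of k j] by (simp add: P'_def)
  next
    fix c :: "'a \<Rightarrow> complex"
    define s where "s = (\<Sum>j\<in>I. P k j * c j)"
    \<comment> \<open>The value at \<open>k\<close> that minimises the form of \<open>P\<close> given the values on \<open>I\<close>: at it the form of \<open>P\<close>
      equals that of \<open>P'\<close>.\<close>
    define c' where "c' = c(k := - s / of_real d)"
    have c'I: "c' i = c i" if "i \<in> I" for i
      using that insert.hyps by (auto simp: c'_def)
    have s: "(\<Sum>j\<in>I. P k j * c' j) = s"
      unfolding s_def by (rule sum.cong) (simp_all add: c'I)
    have "cnj s * s = (\<Sum>i\<in>I. \<Sum>j\<in>I. cnj (c i) * (P i k * P k j) * c j)"
      unfolding s_def cnj_sum sum_product
      by (intro sum.cong refl) (simp add: herm [of k])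
    then have "(\<Sum>i\<in>I. \<Sum>j\<in>I. cnj (c i) * P' i j * c j)
        = (\<Sum>i\<in>I. \<Sum>j\<in>I. cnj (c i) * P i j * c j) - cnj s * s / of_real d"
      by (simp add: P'_def algebra_simps sum_subtractf sum_divide_distrib)
    also have "\<dots> = (\<Sum>i\<in>I. \<Sum>j\<in>I. cnj (c' i) * P i j * c' j) - cnj s * s / of_real d"
      by (simp add: c'I cong: sum.cong)
    also have "\<dots> = (\<Sum>i\<in>insert k I. \<Sum>j\<in>insert k I. cnj (c' i) * P i j * c' j)"
      unfolding split s by (cases "d = 0") (simp_all add: c'_def field_simps)
    finally show "0 \<le> Re (\<Sum>i\<in>I. \<Sum>j\<in>I. cnj (c i) * P' i j * c j)"
      using psd [of c'] by simp
  qed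
  then obtain E where E: "\<And>i j. i \<in> I \<Longrightarrow> j \<in> I \<Longrightarrow> P' i j = (\<Sum>r\<in>I. cnj (E r i) * E r j)"
    by blast
  define F where "F = (\<lambda>r j. if r = k then P k j / of_real (sqrt d) else if j = k then 0 else E r j)"
  have Fk: "cnj (F k i) * F k j = P i k * P k j / of_real d" if "i \<in> insert k I" for i j
    using that d_nonneg herm [of k i]
    by (simp add: F_def of_real_mult [symmetric] del: of_real_mult)
  have "P i j = (\<Sum>r\<in>insert k I. cnj (F r i) * F r j)" if "i \<in> insert k I" "j \<in> insert k I" for i j
  proof -
    have rest: "(\<Sum>r\<in>I. cnj (F r i) * F r j) = (if i = k \<or> j = k then 0 else P' i j)"
    proof (cases "i = k \<or> j = k")
      case True
      then show ?thesis
        using insert.hyps by (auto simp: F_def intro!: sum.neutral)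
    next
      case False
      then have "(\<Sum>r\<in>I. cnj (F r i) * F r j) = (\<Sum>r\<in>I. cnj (E r i) * E r j)"
        using insert.hyps by (intro sum.cong) (auto simp: F_def)
      with False that show ?thesis
        by (simp add: E)
    qed
    have zero: "P i j = 0" if "d = 0" "i = k \<or> j = k"
      using that \<open>i \<in> insert k I\<close> \<open>j \<in> insert k I\<close> row_zero Pkk herm [of k i] by auto
    show ?thesis
      using insert.hyps zero
      by (simp add: Fk [OF that(1)] rest Pkk P'_def) (auto simp: Pkk)
  qed
  then show ?case by blast
qed

lemma kronecker_nth: "(A \<otimes>\<^sub>K B) x $ i = (\<Sum>j\<in>UNIV. A $ i $ j *\<^sub>C B (x $ j))"
  by (simp add: kronecker_def)

text \<open>
  The matrix \<open>E\<close> satisfies \<open>E\<^sup>*E = I - A\<^sup>*A\<close>.  The identity is stated for the amplified matrices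
  on an arbitrary space because that is where the two are compared later; it follows from the scalar one
  because the inner product of the images under \<open>M \<otimes> I\<close> depends on \<open>M\<close> only through \<open>M\<^sup>*M\<close>.
\<close>
lemma contraction_complement:
  fixes A :: "complex ^ 'n ^ 'n"
  assumes "\<And>c. norm (A *v c) \<le> norm c"
  shows "\<exists>E :: complex ^ 'n ^ 'n. \<forall>v w :: 'h::complex_inner ^ 'n.
    cinner ((E \<otimes>\<^sub>K (\<lambda>h. h)) v) ((E \<otimes>\<^sub>K (\<lambda>h. h)) w)
      = cinner v w - cinner ((A \<otimes>\<^sub>K (\<lambda>h. h)) v) ((A \<otimes>\<^sub>K (\<lambda>h. h)) w)"
proof -
  define P where "P = (\<lambda>i j. (if i = j then 1 else 0) - (\<Sum>m\<in>UNIV. cnj (A $ m $ i) * A $ m $ j))"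
  have gram: "cinner ((M \<otimes>\<^sub>K (\<lambda>h. h)) v) ((M \<otimes>\<^sub>K (\<lambda>h. h)) w)
      = (\<Sum>i\<in>UNIV. \<Sum>j\<in>UNIV. (\<Sum>m\<in>UNIV. cnj (M $ m $ i) * M $ m $ j) * cinner (v $ j) (w $ i))"
    for M :: "complex ^ 'n ^ 'n" and v w :: "'k::complex_inner ^ 'n"
  proof -
    have "cinner ((M \<otimes>\<^sub>K (\<lambda>h. h)) v) ((M \<otimes>\<^sub>K (\<lambda>h. h)) w)
        = (\<Sum>m\<in>UNIV. \<Sum>i\<in>UNIV. \<Sum>j\<in>UNIV. cnj (M $ m $ i) * M $ m $ j * cinner (v $ j) (w $ i))"
      by (simp add: cinner_vec_def kronecker_nth cinner_sum_left cinner_sum_right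
          cinner_scaleC_left cinner_scaleC_right sum_distrib_left mult_ac)
    also have "\<dots> = (\<Sum>i\<in>UNIV. \<Sum>m\<in>UNIV. \<Sum>j\<in>UNIV. cnj (M $ m $ i) * M $ m $ j * cinner (v $ j) (w $ i))"
      by (rule sum.swap)
    also have "\<dots> = (\<Sum>i\<in>UNIV. \<Sum>j\<in>UNIV. \<Sum>m\<in>UNIV. cnj (M $ m $ i) * M $ m $ j * cinner (v $ j) (w $ i))"
      by (intro sum.cong refl sum.swap)
    finally show ?thesis
      by (simp add: sum_distrib_right)
  qed
  have form: "(\<Sum>i\<in>UNIV. \<Sum>j\<in>UNIV. P i j * cinner (v $ j) (w $ i))
      = cinner v w - cinner ((A \<otimes>\<^sub>K (\<lambda>h. h)) v) ((A \<otimes>\<^sub>K (\<lambda>h. h)) w)"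
    for v w :: "'k::complex_inner ^ 'n"
  proof -
    have "(\<Sum>i\<in>UNIV. \<Sum>j\<in>UNIV. (if i = j then 1 else 0) * cinner (v $ j) (w $ i))
        = (\<Sum>i\<in>UNIV. \<Sum>j\<in>UNIV. if i = j then cinner (v $ j) (w $ i) else 0)"
      by (intro sum.cong refl) simp
    also have "\<dots> = cinner v w"
      by (simp add: cinner_vec_def)
    finally show ?thesis
      by (simp add: gram P_def left_diff_distrib sum_subtractf)
  qed
  have "\<exists>E :: 'n \<Rightarrow> 'n \<Rightarrow> complex. \<forall>i\<in>UNIV. \<forall>j\<in>UNIV. P i j = (\<Sum>r\<in>UNIV. cnj (E r i) * E r j)"
  proof (rule psd_gram)
    show "P j i = cnj (P i j)" for i j
      by (simp add: P_def mult.commute)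
  next
    fix c :: "'n \<Rightarrow> complex"
    define v where "v = (\<chi> i. c i)"
    have Av: "(A \<otimes>\<^sub>K (\<lambda>h. h)) v = A *v v"
      by (simp add: vec_eq_iff kronecker_nth scaleC_complex_def matrix_vector_mult_def)
    have "(\<Sum>i\<in>UNIV. \<Sum>j\<in>UNIV. cnj (c i) * P i j * c j)
        = (\<Sum>i\<in>UNIV. \<Sum>j\<in>UNIV. P i j * cinner (v $ j) (v $ i))"
      by (simp add: v_def cinner_complex_def mult_ac)
    also have "\<dots> = of_real ((norm v)\<^sup>2 - (norm (A *v v))\<^sup>2)"
      unfolding form Av cinner_self by simp
    finally show "0 \<le> Re (\<Sum>i\<in>UNIV. \<Sum>j\<in>UNIV. cnj (c i) * P i j * c j)"
      using power_mono [OF assms [of v] norm_ge_zero, of 2] by simp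
  qed simp
  then obtain E :: "'n \<Rightarrow> 'n \<Rightarrow> complex" where E: "\<And>i j. P i j = (\<Sum>r\<in>UNIV. cnj (E r i) * E r j)"
    by auto
  show ?thesis
    unfolding form [symmetric]
    unfolding gram by (rule exI [where x = "\<chi> r i. E r i"]) (simp add: E)
qed

section \<open>Numerical radius of a Kronecker product\<close>

text \<open>
  With \<open>T\<close>, \<open>S\<close>, \<open>D\<close> as in the introduction, let \<open>u k = T\<^sup>k x\<close> and \<open>b k = \<langle>D (u (k + 1)), u k\<rangle>\<close>; the claim
  concerns \<open>b 0 = \<langle>(A \<otimes> B) x, x\<rangle>\<close>.  For the sequence \<open>S (u k)\<close> both sides of the shift bound
  telescope, since \<open>S\<^sup>*S = I - T\<^sup>*T\<close>, and the result controls \<open>b 0 - b L\<close>.  The remaining \<open>b L\<close>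
  need not tend to \<open>0\<close>, but the shift bound for the sequence \<open>u k\<close> itself controls their sum over \<open>L < N\<close>.
  Adding these estimates gives \<open>N |b 0| \<le> (N + 1) w(B) \<parallel>x\<parallel>\<^sup>2\<close> for every \<open>N\<close>.
\<close>
lemma cinner_kronecker_le_if_contraction:
  fixes A :: "complex ^ 'n ^ 'n" and B :: "'h::complex_inner \<Rightarrow> 'h"
  assumes contr: "\<And>c. norm (A *v c) \<le> norm c" and B: "bounded_clinear B"
  shows "cmod (cinner ((A \<otimes>\<^sub>K B) x) x) \<le> numerical_radius B * (norm x)\<^sup>2"
proof -
  define w where "w = numerical_radius B"
  define T where "T = (A \<otimes>\<^sub>K (\<lambda>h::'h. h))"
  define D where "D = (\<lambda>v :: 'h ^ 'n. \<chi> i. B (v $ i))"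
  obtain E :: "complex ^ 'n ^ 'n" where E:
    "\<And>v w :: 'h ^ 'n. cinner ((E \<otimes>\<^sub>K (\<lambda>h. h)) v) ((E \<otimes>\<^sub>K (\<lambda>h. h)) w) = cinner v w - cinner (T v) (T w)"
    unfolding T_def using contraction_complement [OF contr] by blast
  define S where "S = (E \<otimes>\<^sub>K (\<lambda>h::'h. h))"
  have D_commute: "D ((M \<otimes>\<^sub>K (\<lambda>h. h)) v) = (M \<otimes>\<^sub>K (\<lambda>h. h)) (D v)" for M v
    by (simp add: D_def vec_eq_iff kronecker_nth bounded_clinear_sum [OF B] bounded_clinear_scaleC [OF B])
  have D_bound: "cmod (cinner (D v) v) \<le> w * (norm v)\<^sup>2" for v
  proof -
    have "cmod (cinner (D v) v) \<le> (\<Sum>i\<in>UNIV. w * (norm (v $ i))\<^sup>2)"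
      unfolding cinner_vec_def D_def w_def
      by (rule sum_norm_le) (simp add: cinner_le_numerical_radius [OF B])
    also have "\<dots> = w * (norm v)\<^sup>2"
      by (simp add: norm_vec_def L2_set_def sum_nonneg sum_distrib_left)
    finally show ?thesis .
  qed
  have shift: "cmod (\<Sum>k<N. cinner (D (\<xi> (Suc k))) (\<xi> k)) \<le> w * (\<Sum>k\<le>N. (norm (\<xi> k))\<^sup>2)" for N \<xi>
    by (rule shift_numerical_bound [OF _ _ D_bound])
      (simp_all add: D_def vec_eq_iff bounded_clinear_add [OF B] bounded_clinear_scaleC [OF B]
        scaleC_vec_def)
  define u where "u = (\<lambda>k. (T ^^ k) x)"
  define b where "b = (\<lambda>k. cinner (D (u (Suc k))) (u k))"
  have u_Suc: "u (Suc k) = T (u k)" for k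
    by (simp add: u_def)
  have norm_S: "(norm (S v))\<^sup>2 = (norm v)\<^sup>2 - (norm (T v))\<^sup>2" for v
  proof -
    have "complex_of_real ((norm (S v))\<^sup>2) = of_real ((norm v)\<^sup>2 - (norm (T v))\<^sup>2)"
      using E [of v v] by (simp add: S_def cinner_self)
    then show ?thesis
      unfolding of_real_eq_iff .
  qed
  have S_terms: "cinner (D (S (u (Suc k)))) (S (u k)) = b k - b (Suc k)" for k
    unfolding S_def D_commute E by (simp add: b_def T_def u_Suc D_commute)
  have tail: "cmod (b 0 - b L) \<le> w * ((norm x)\<^sup>2 - (norm (u (Suc L)))\<^sup>2)" for L
  proof -
    have "b 0 - b L = (\<Sum>k<L. cinner (D (S (u (Suc k)))) (S (u k)))"
      unfolding S_terms by (rule sum_lessThan_telescope' [symmetric])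
    also have "cmod \<dots> \<le> w * (\<Sum>k\<le>L. (norm (S (u k)))\<^sup>2)"
      by (rule shift)
    also have "(\<Sum>k\<le>L. (norm (S (u k)))\<^sup>2) = (norm (u 0))\<^sup>2 - (norm (u (Suc L)))\<^sup>2"
      unfolding norm_S u_Suc [symmetric] by (rule sum_telescope)
    finally show ?thesis
      by (simp add: u_def)
  qed
  have avg: "real N * cmod (b 0) \<le> real N * (w * (norm x)\<^sup>2) + w * (norm x)\<^sup>2" for N
  proof -
    have "of_nat N * b 0 = (\<Sum>L<N. b 0 - b L) + (\<Sum>k<N. b k)"
      by (simp add: sum_subtractf)
    then have "real N * cmod (b 0) = cmod ((\<Sum>L<N. b 0 - b L) + (\<Sum>k<N. b k))"
      by (metis norm_mult norm_of_nat)
    also have "\<dots> \<le> (\<Sum>L<N. w * ((norm x)\<^sup>2 - (norm (u (Suc L)))\<^sup>2)) + w * (\<Sum>k\<le>N. (norm (u k))\<^sup>2)"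
      unfolding b_def
      by (intro norm_triangle_mono sum_norm_le tail [unfolded b_def] shift)
    also have "(\<Sum>k\<le>N. (norm (u k))\<^sup>2) = (norm x)\<^sup>2 + (\<Sum>L<N. (norm (u (Suc L)))\<^sup>2)"
      by (simp add: sum.atMost_shift u_def)
    finally show ?thesis
      by (simp add: sum_subtractf sum_distrib_left [symmetric] algebra_simps)
  qed
  have bound: "cmod (b 0) \<le> w * (norm x)\<^sup>2 + w * (norm x)\<^sup>2 / real (Suc N)" for N
    using avg [of "Suc N"] by (simp add: field_simps del: of_nat_Suc)
  have "(\<lambda>N. w * (norm x)\<^sup>2 + w * (norm x)\<^sup>2 / real (Suc N)) \<longlonglongrightarrow> w * (norm x)\<^sup>2 + 0"
    by (intro tendsto_add tendsto_const LIMSEQ_Suc lim_const_over_n)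
  then have "cmod (b 0) \<le> w * (norm x)\<^sup>2 + 0"
    by (rule LIMSEQ_le_const) (use bound in blast)
  moreover have "D (T x) = (A \<otimes>\<^sub>K B) x"
    unfolding T_def D_commute by (simp add: D_def vec_eq_iff kronecker_nth)
  ultimately show ?thesis
    by (simp add: b_def u_def w_def)
qed

lemma cinner_kronecker_le:
  fixes A :: "complex ^ 'n ^ 'n" and B :: "'h::complex_inner \<Rightarrow> 'h"
  assumes B: "bounded_clinear B"
  shows "cmod (cinner ((A \<otimes>\<^sub>K B) x) x) \<le> onorm ((*v) A) * numerical_radius B * (norm x)\<^sup>2"
proof -
  \<comment> \<open>Dividing by any \<open>s > \<parallel>A\<parallel>\<close> instead of \<open>\<parallel>A\<parallel>\<close> covers \<open>A = 0\<close> as well.\<close>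
  let ?y = "numerical_radius B * (norm x)\<^sup>2"
  have scaled: "cmod (cinner ((A \<otimes>\<^sub>K B) x) x) \<le> s * ?y" if s: "onorm ((*v) A) < s" for s
  proof -
    have "0 < s"
      using s onorm_pos_le [OF matrix_vector_mul_bounded_linear [of A]] by simp
    define A' where "A' = (\<chi> i j. A $ i $ j / of_real s)"
    have A': "A' *v c = (1 / s) *\<^sub>R (A *v c)" for c
      by (simp add: A'_def matrix_vector_mult_def vec_eq_iff
          scaleR_conv_of_real [where 'a = complex]
          sum_distrib_left)
    have "norm (A' *v c) \<le> norm c" for c
    proof -
      have "norm (A *v c) \<le> onorm ((*v) A) * norm c"
        by (rule onorm) simp
      also have "\<dots> \<le> s * norm c"
        using s by (simp add: mult_right_mono)
      finally show ?thesis
        using \<open>0 < s\<close> by (simp add: A' field_simps)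
    qed
    then have "cmod (cinner ((A' \<otimes>\<^sub>K B) x) x) \<le> ?y"
      by (rule cinner_kronecker_le_if_contraction [OF _ B])
    moreover have "(A \<otimes>\<^sub>K B) x = of_real s *\<^sub>C (A' \<otimes>\<^sub>K B) x"
      using \<open>0 < s\<close>
      by (simp add: vec_eq_iff kronecker_nth scaleC_vec_def scaleC_sum_right scaleC_scaleC A'_def)
    ultimately show ?thesis
      using \<open>0 < s\<close> by (simp add: cinner_scaleC_left norm_mult)
  qed
  have "cmod (cinner ((A \<otimes>\<^sub>K B) x) x) \<le> onorm ((*v) A) * ?y"
  proof (rule tendsto_lowerbound)
    show "((\<lambda>s. s * ?y) \<longlongrightarrow> onorm ((*v) A) * ?y) (at_right (onorm ((*v) A)))"
      by (intro tendsto_intros)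
    show "\<forall>\<^sub>F s in at_right (onorm ((*v) A)). cmod (cinner ((A \<otimes>\<^sub>K B) x) x) \<le> s * ?y"
      by (intro eventually_at_right_less [THEN eventually_mono] scaled)
  qed simp
  then show ?thesis
    by (simp add: mult.assoc)
qed

lemma exists_nonzero_vec: "\<exists>h::'h::real_normed_vector. h \<noteq> 0 \<Longrightarrow> \<exists>x::'h ^ 'n. x \<noteq> 0"
proof -
  assume "\<exists>h::'h. h \<noteq> 0"
  then obtain h :: 'h where "h \<noteq> 0" ..
  then have "(\<chi> i. h) \<noteq> (0 :: 'h ^ 'n)"
    by (simp add: vec_eq_iff)
  then show "\<exists>x::'h ^ 'n. x \<noteq> 0" ..
qed

lemma numerical_radius_kronecker_le:
  fixes A :: "complex ^ 'n ^ 'n" and B :: "'h::complex_inner \<Rightarrow> 'h"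
  assumes "\<exists>x::'h. x \<noteq> 0" and "bounded_clinear B"
  shows "numerical_radius (A \<otimes>\<^sub>K B) \<le> onorm ((*v) A) * numerical_radius B"
proof (rule numerical_radius_least)
  show "\<exists>x :: 'h ^ 'n. x \<noteq> 0"
    using assms(1) by (rule exists_nonzero_vec)
  show "cmod (cinner ((A \<otimes>\<^sub>K B) x) x) \<le> onorm ((*v) A) * numerical_radius B" if "norm x = 1" for x
    using cinner_kronecker_le [OF assms(2), of A x] that by simp
qed

lemma cinner_kronecker_elementary:
  fixes A :: "complex ^ 'n ^ 'n" and B :: "'h::complex_inner \<Rightarrow> 'h"
  assumes "bounded_clinear B"
  defines "t \<equiv> \<lambda>(c :: complex ^ 'n) (h :: 'h). (\<chi> i. c $ i *\<^sub>C h) :: 'h ^ 'n"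
  shows "cinner ((A \<otimes>\<^sub>K B) (t c h)) (t d g) = cinner (A *v c) d * cinner (B h) g"
    and "norm (t c h) = norm c * norm h"
proof -
  have "(A \<otimes>\<^sub>K B) (t c h) = t (A *v c) (B h)"
    by (simp add: vec_eq_iff t_def kronecker_def bounded_clinear_scaleC [OF assms(1)]
        scaleC_scaleC matrix_vector_mult_def scaleC_sum_left)
  then show "cinner ((A \<otimes>\<^sub>K B) (t c h)) (t d g) = cinner (A *v c) d * cinner (B h) g"
    by (simp add: t_def cinner_vec_def cinner_scaleC_left cinner_scaleC_right cinner_complex_def
        sum_distrib_left mult_ac)
  show "norm (t c h) = norm c * norm h"
    by (simp add: t_def norm_vec_def norm_scaleC L2_set_left_distrib)
qed

lemma numerical_radius_kronecker_ge:
  fixes A :: "complex ^ 'n ^ 'n" and B :: "'h::complex_inner \<Rightarrow> 'h"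
  assumes ex: "\<exists>x::'h. x \<noteq> 0" and B: "bounded_clinear B"
  shows "numerical_radius ((*v) A) * numerical_radius B \<le> numerical_radius (A \<otimes>\<^sub>K B)"
proof -
  define W where "W = numerical_radius (A \<otimes>\<^sub>K B)"
  have prod: "cmod (cinner (A *v c) c) * cmod (cinner (B h) h) \<le> W" if "norm c = 1" "norm h = 1" for c h
  proof -
    define x where "x = (\<chi> i. c $ i *\<^sub>C h)"
    have "norm x = 1"
      unfolding x_def cinner_kronecker_elementary(2) [OF B] using that by simp
    then have "cmod (cinner ((A \<otimes>\<^sub>K B) x) x) \<le> W"
      unfolding W_def by (rule numerical_radius_upper [OF cinner_kronecker_le [OF B]])
    then show ?thesis
      unfolding x_def cinner_kronecker_elementary(1) [OF B] by (simp add: norm_mult)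
  qed
  have exn: "\<exists>c :: complex ^ 'n. c \<noteq> 0"
    by (rule exists_nonzero_vec) (rule exI [of _ 1], simp)
  obtain c0 :: "complex ^ 'n" and h0 :: 'h where 1: "norm c0 = 1" "norm h0 = 1"
    using exists_norm_one [OF exn] exists_norm_one [OF ex] by blast
  have W: "0 \<le> W"
    using order_trans [OF _ prod [OF 1]] by simp
  have "cmod (cinner (A *v c) c) * numerical_radius B \<le> W" if c: "norm c = 1" for c
  proof (cases "cinner (A *v c) c = 0")
    case False
    have "numerical_radius B \<le> W / cmod (cinner (A *v c) c)"
      by (rule numerical_radius_least [OF ex])
        (use prod [OF c] False in \<open>simp add: pos_le_divide_eq mult.commute\<close>)
    then show ?thesis
      using False by (simp add: pos_le_divide_eq mult.commute)
  qed (simp add: W)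
  note * = this
  show ?thesis
  proof (cases "numerical_radius B = 0")
    case False
    then have pos: "0 < numerical_radius B"
      using numerical_radius_nonneg [OF ex B] by simp
    have "numerical_radius ((*v) A) \<le> W / numerical_radius B"
      by (rule numerical_radius_least [OF exn]) (use * pos in \<open>simp add: pos_le_divide_eq\<close>)
    then show ?thesis
      using pos by (simp add: pos_le_divide_eq W_def)
  qed (use W in \<open>simp add: W_def\<close>)
qed

section \<open>The Schur test\<close>

text \<open>
  Jensen's inequality for \<open>\<lambda>t. t powr p\<close> with weights proportional to \<open>a\<close>.  The summands with \<open>t j = 0\<close>
  are removed first, because the convexity used is that on the open half-line.
\<close>
lemma sum_powr_le:
  fixes a t :: "'i \<Rightarrow> real"
  assumes "finite I" "1 \<le> p" "\<And>j. j \<in> I \<Longrightarrow> 0 \<le> a j" "\<And>j. j \<in> I \<Longrightarrow> 0 \<le> t j"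
  shows "(\<Sum>j\<in>I. a j * t j) powr p \<le> (\<Sum>j\<in>I. a j) powr (p - 1) * (\<Sum>j\<in>I. a j * t j powr p)"
proof -
  define J where "J = {j\<in>I. t j \<noteq> 0}"
  define s where "s = (\<Sum>j\<in>J. a j)"
  have J: "finite J" "\<And>j. j \<in> J \<Longrightarrow> 0 < t j" "\<And>j. j \<in> J \<Longrightarrow> 0 \<le> a j" "J \<subseteq> I"
    using assms by (auto simp: J_def less_le)
  have restrict: "(\<Sum>j\<in>I. a j * t j) = (\<Sum>j\<in>J. a j * t j)"
    "(\<Sum>j\<in>I. a j * t j powr p) = (\<Sum>j\<in>J. a j * t j powr p)"
    using assms by (auto simp: J_def intro!: sum.mono_neutral_right)
  have s_nonneg: "0 \<le> s"
    unfolding s_def by (rule sum_nonneg) (rule J)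
  have sum_nonneg': "0 \<le> (\<Sum>j\<in>J. a j * t j powr p)"
    by (rule sum_nonneg) (simp add: J)
  show ?thesis
  proof (cases "s = 0")
    case True
    then have "\<And>j. j \<in> J \<Longrightarrow> a j = 0"
      using J by (simp add: s_def sum_nonneg_eq_0_iff)
    then have "(\<Sum>j\<in>J. a j * t j) = 0"
      by simp
    then show ?thesis
      using sum_nonneg' by (simp add: restrict)
  next
    case False
    then have s: "0 < s"
      using s_nonneg by simp
    have "J \<noteq> {}"
      using False by (auto simp: s_def)
    have "(\<Sum>j\<in>J. (a j / s) *\<^sub>R t j) powr p \<le> (\<Sum>j\<in>J. a j / s * t j powr p)"
      by (rule convex_on_sum [OF \<open>finite J\<close> \<open>J \<noteq> {}\<close> powr_convex [OF assms(2)]])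
        (use J s in \<open>auto simp: sum_divide_distrib [symmetric] s_def\<close>)
    also have "(\<Sum>j\<in>J. (a j / s) *\<^sub>R t j) = (\<Sum>j\<in>J. a j * t j) / s"
      by (simp add: sum_divide_distrib)
    also have "(\<Sum>j\<in>J. a j / s * t j powr p) = (\<Sum>j\<in>J. a j * t j powr p) / s"
      by (simp add: sum_divide_distrib)
    finally have "((\<Sum>j\<in>J. a j * t j) / s) powr p \<le> (\<Sum>j\<in>J. a j * t j powr p) / s" .
    moreover have "0 \<le> (\<Sum>j\<in>J. a j * t j)"
      by (rule sum_nonneg) (simp add: J less_imp_le)
    ultimately have "(\<Sum>j\<in>J. a j * t j) powr p \<le> s powr p / s * (\<Sum>j\<in>J. a j * t j powr p)"
      using s by (simp add: powr_divide field_simps)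
    also have "s powr p / s = s powr (p - 1)"
      using s by (simp add: powr_diff)
    also have "s powr (p - 1) * (\<Sum>j\<in>J. a j * t j powr p)
        \<le> (\<Sum>j\<in>I. a j) powr (p - 1) * (\<Sum>j\<in>J. a j * t j powr p)"
    proof (rule mult_right_mono [OF powr_mono2])
      show "s \<le> (\<Sum>j\<in>I. a j)"
        unfolding s_def by (rule sum_mono2) (use assms J in auto)
    qed (use assms(2) s_nonneg sum_nonneg' in auto)
    finally show ?thesis
      unfolding restrict .
  qed
qed

lemma Schur_test_sum:
  fixes a :: "'i \<Rightarrow> 'j \<Rightarrow> real"
  assumes "finite I" "finite J" "1 \<le> p"
    and nonneg: "\<And>i j. i \<in> I \<Longrightarrow> j \<in> J \<Longrightarrow> 0 \<le> a i j" "\<And>j. j \<in> J \<Longrightarrow> 0 \<le> t j"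
    and row: "\<And>i. i \<in> I \<Longrightarrow> (\<Sum>j\<in>J. a i j) \<le> R"
    and col: "\<And>j. j \<in> J \<Longrightarrow> (\<Sum>i\<in>I. a i j) \<le> C"
  shows "(\<Sum>i\<in>I. (\<Sum>j\<in>J. a i j * t j) powr p) \<le> R powr (p - 1) * C * (\<Sum>j\<in>J. t j powr p)"
proof -
  have "(\<Sum>i\<in>I. (\<Sum>j\<in>J. a i j * t j) powr p) \<le> (\<Sum>i\<in>I. R powr (p - 1) * (\<Sum>j\<in>J. a i j * t j powr p))"
  proof (rule sum_mono)
    fix i assume i: "i \<in> I"
    have "(\<Sum>j\<in>J. a i j * t j) powr p \<le> (\<Sum>j\<in>J. a i j) powr (p - 1) * (\<Sum>j\<in>J. a i j * t j powr p)"
      by (rule sum_powr_le) (use assms i in auto)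
    also have "\<dots> \<le> R powr (p - 1) * (\<Sum>j\<in>J. a i j * t j powr p)"
      using i assms(3) by (intro mult_right_mono powr_mono2 row sum_nonneg) (auto simp: nonneg)
    finally show "(\<Sum>j\<in>J. a i j * t j) powr p \<le> R powr (p - 1) * (\<Sum>j\<in>J. a i j * t j powr p)" .
  qed
  also have "\<dots> = R powr (p - 1) * (\<Sum>j\<in>J. (\<Sum>i\<in>I. a i j) * t j powr p)"
    unfolding sum_distrib_left [symmetric] sum_distrib_right
    by (rule arg_cong [OF sum.swap])
  also have "\<dots> \<le> R powr (p - 1) * (\<Sum>j\<in>J. C * t j powr p)"
    by (intro mult_left_mono sum_mono mult_right_mono col) auto
  finally show ?thesis
    by (simp add: sum_distrib_left [symmetric] mult.assoc)
qed

text \<open>The Schur test for \<open>p = 2\<close>, applied to the moduli of the entries.\<close>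
lemma onorm_le_Schur:
  fixes A :: "complex ^ 'n ^ 'n"
  shows "onorm ((*v) A) \<le> sqrt (MAX i. \<Sum>j\<in>UNIV. cmod (A $ i $ j))
    * sqrt (MAX j. \<Sum>i\<in>UNIV. cmod (A $ i $ j))" (is "_ \<le> sqrt ?R * sqrt ?C")
proof (rule onorm_le)
  fix c :: "complex ^ 'n"
  have row: "(\<Sum>j\<in>UNIV. cmod (A $ i $ j)) \<le> ?R" for i
    by (rule Max_ge) auto
  have col: "(\<Sum>i\<in>UNIV. cmod (A $ i $ j)) \<le> ?C" for j
    by (rule Max_ge) auto
  have R: "0 \<le> ?R"
    by (rule order_trans [OF sum_nonneg row]) simp
  have "(norm (A *v c))\<^sup>2 = (\<Sum>i\<in>UNIV. (cmod (\<Sum>j\<in>UNIV. A $ i $ j * c $ j))\<^sup>2)"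
    by (simp add: norm_vec_def L2_set_def matrix_vector_mult_def sum_nonneg)
  also have "\<dots> \<le> (\<Sum>i\<in>UNIV. (\<Sum>j\<in>UNIV. cmod (A $ i $ j) * cmod (c $ j)) powr 2)"
    by (intro sum_mono)
      (auto simp: sum_nonneg norm_mult [symmetric] intro!: power_mono norm_sum)
  also have "\<dots> \<le> ?R powr (2 - 1) * ?C * (\<Sum>j\<in>UNIV. cmod (c $ j) powr 2)"
    by (rule Schur_test_sum) (auto simp: row col)
  also have "\<dots> = ?R * ?C * (norm c)\<^sup>2"
    using R by (simp add: norm_vec_def L2_set_def sum_nonneg)
  finally have "norm (A *v c) \<le> sqrt (?R * ?C * (norm c)\<^sup>2)"
    by (rule real_le_rsqrt)
  then show "norm (A *v c) \<le> sqrt ?R * sqrt ?C * norm c"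
    by (simp add: real_sqrt_mult)
qed

section \<open>The lp operator norm of a Kronecker product\<close>

lemma lp_norm_top: "lp_norm top x = (MAX j. norm (x $ j))"
  by (simp add: lp_norm_def)

lemma lp_norm_ennreal:
  "0 \<le> r \<Longrightarrow> lp_norm (ennreal r) x = (\<Sum>j\<in>UNIV. norm (x $ j) powr r) powr (1 / r)"
  by (simp add: lp_norm_def)

lemma conjugate_exponents_cases [consumes 2, case_names top finite]:
  fixes p q :: ennreal
  assumes "1 \<le> p" "1 / p + 1 / q = 1"
  obtains "p = top" "enn2real (1 / p) = 0" "enn2real (1 / q) = 1"
  | r where "1 \<le> r" "p = ennreal r" "enn2real (1 / p) = 1 / r" "enn2real (1 / q) = 1 - 1 / r"
proof (cases p)
  case top
  then show ?thesis
    using that(1) assms(2) by simp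
next
  case (real r)
  have "1 \<le> r"
    using assms(1) real by (simp add: ennreal_ge_1)
  then have p: "1 / p = ennreal (1 / r)"
    using real divide_ennreal [of 1 r] by simp
  obtain s where s: "1 / q = ennreal s" "0 \<le> s"
    using assms(2) by (cases "1 / q") auto
  have "ennreal (1 / r + s) = ennreal 1"
    using assms(2) \<open>1 \<le> r\<close> s by (simp add: p ennreal_plus)
  then have "1 / r + s = 1"
    using \<open>1 \<le> r\<close> s by (subst (asm) ennreal_inj) auto
  then show ?thesis
    using that(2) [of r] real \<open>1 \<le> r\<close> p s by simp
qed

lemma lp_norm_pos:
  assumes "1 \<le> p" "x \<noteq> 0"
  shows "0 < lp_norm p x"
proof -
  obtain j where j: "x $ j \<noteq> 0"
    using assms(2) by (auto simp: vec_eq_iff)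
  show ?thesis
  proof (cases p)
    case top
    have "norm (x $ j) \<le> lp_norm p x"
      unfolding top lp_norm_top by (rule Max_ge) auto
    with j show ?thesis
      by (metis zero_less_norm_iff less_le_trans)
  next
    case (real r)
    have "0 < (\<Sum>j\<in>UNIV. norm (x $ j) powr r)"
      by (rule sum_pos2 [of _ j]) (use j in auto)
    then show ?thesis
      using real by (simp add: lp_norm_ennreal)
  qed
qed

lemma lp_norm_nonneg: "0 \<le> lp_norm p x"
proof (cases "p = top")
  case True
  then show ?thesis
    unfolding True lp_norm_top by (intro order_trans [OF norm_ge_zero Max_ge]) auto
qed (simp add: lp_norm_def)

lemma lp_norm_kronecker_le:
  fixes A :: "complex ^ 'n ^ 'n" and B :: "'h::complex_inner \<Rightarrow> 'h"
  assumes B: "bounded_clinear B" and pq: "1 \<le> p" "1 / p + 1 / q = 1"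
  shows "lp_norm p ((A \<otimes>\<^sub>K B) x)
    \<le> rpow (MAX i. \<Sum>j\<in>UNIV. cmod (A $ i $ j)) (enn2real (1 / q))
      * rpow (MAX j. \<Sum>i\<in>UNIV. cmod (A $ i $ j)) (enn2real (1 / p)) * onorm B * lp_norm p x"
    (is "_ \<le> rpow ?R _ * rpow ?C _ * _ * _")
proof -
  have B_nonneg: "0 \<le> onorm B"
    using B by (simp add: bounded_clinear_def onorm_pos_le)
  have row: "(\<Sum>j\<in>UNIV. cmod (A $ i $ j)) \<le> ?R" for i
    by (rule Max_ge) auto
  have col: "(\<Sum>i\<in>UNIV. cmod (A $ i $ j)) \<le> ?C" for j
    by (rule Max_ge) auto
  have R: "0 \<le> ?R"
    by (rule order_trans [OF sum_nonneg row]) simp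
  have C: "0 \<le> ?C"
    by (rule order_trans [OF sum_nonneg col]) simp
  have entry: "norm ((A \<otimes>\<^sub>K B) x $ i) \<le> onorm B * (\<Sum>j\<in>UNIV. cmod (A $ i $ j) * norm (x $ j))" for i
  proof -
    have "norm ((A \<otimes>\<^sub>K B) x $ i) \<le> (\<Sum>j\<in>UNIV. cmod (A $ i $ j) * norm (B (x $ j)))"
      by (simp add: kronecker_def norm_sum_scaleC_le)
    also have "\<dots> \<le> (\<Sum>j\<in>UNIV. cmod (A $ i $ j) * (onorm B * norm (x $ j)))"
      by (intro sum_mono mult_left_mono norm_le_onorm_if_bounded_clinear [OF B]) simp
    finally show ?thesis
      by (simp add: sum_distrib_left mult_ac)
  qed
  from pq show ?thesis
  proof (cases rule: conjugate_exponents_cases)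
    case top
    have "norm ((A \<otimes>\<^sub>K B) x $ i) \<le> ?R * onorm B * lp_norm top x" for i
    proof -
      have "(\<Sum>j\<in>UNIV. cmod (A $ i $ j) * norm (x $ j)) \<le> (\<Sum>j\<in>UNIV. cmod (A $ i $ j) * lp_norm top x)"
        unfolding lp_norm_top by (intro sum_mono mult_left_mono Max_ge) auto
      also have "\<dots> \<le> ?R * lp_norm top x"
        unfolding sum_distrib_right [symmetric] by (intro mult_right_mono row lp_norm_nonneg)
      finally have "onorm B * (\<Sum>j\<in>UNIV. cmod (A $ i $ j) * norm (x $ j)) \<le> onorm B * (?R * lp_norm top x)"
        using B_nonneg by (rule mult_left_mono)
      with entry [of i] show ?thesis
        by (simp only: mult_ac)
    qed
    then have "lp_norm top ((A \<otimes>\<^sub>K B) x) \<le> ?R * onorm B * lp_norm top x"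
      unfolding lp_norm_top [of "(A \<otimes>\<^sub>K B) x"] by (subst Max_le_iff) auto
    then show ?thesis
      using R unfolding top(2,3) by (simp add: top(1) rpow_def)
  next
    case (finite r)
    \<comment> \<open>Only an inequality holds between \<open>R powr (r - 1)\<close> and \<open>\<rho> powr r\<close>: for \<open>r = 1\<close> and \<open>R = 0\<close> the former
      is \<open>0 powr 0 = 0\<close>, while \<open>rpow\<close> gives \<open>1\<close>.\<close>
    define \<rho> where "\<rho> = rpow ?R (1 - 1 / r)"
    define \<gamma> where "\<gamma> = rpow ?C (1 / r)"
    define X where "X = (\<Sum>j\<in>UNIV. norm (x $ j) powr r)"
    have "(1 - 1 / r) * r = r - 1"
      using finite(1) by (simp add: field_simps)
    then have \<rho>: "0 \<le> \<rho>" "?R powr (r - 1) \<le> \<rho> powr r"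
      by (auto simp: \<rho>_def rpow_def powr_powr)
    have \<gamma>: "0 \<le> \<gamma>" "?C = \<gamma> powr r"
      using finite(1) C by (auto simp: \<gamma>_def rpow_def powr_powr)
    have X: "0 \<le> X"
      by (simp add: X_def sum_nonneg)
    have "(\<Sum>i\<in>UNIV. norm ((A \<otimes>\<^sub>K B) x $ i) powr r)
        \<le> (\<Sum>i\<in>UNIV. onorm B powr r * (\<Sum>j\<in>UNIV. cmod (A $ i $ j) * norm (x $ j)) powr r)"
      using finite(1) B_nonneg
      by (intro sum_mono order_trans [OF powr_mono2 [OF _ _ entry]]) (auto simp: powr_mult sum_nonneg)
    also have "\<dots> \<le> onorm B powr r * (?R powr (r - 1) * ?C * (\<Sum>j\<in>UNIV. norm (x $ j) powr r))"
      unfolding sum_distrib_left [symmetric] using finite(1)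
      by (intro mult_left_mono Schur_test_sum) (auto simp: row col)
    also have "\<dots> \<le> onorm B powr r * (\<rho> powr r * \<gamma> powr r * X)"
      unfolding X_def [symmetric] \<gamma>(2) [symmetric]
      using C X by (intro mult_left_mono mult_right_mono \<rho>(2)) auto
    also have "\<dots> = (\<rho> * \<gamma> * onorm B) powr r * X"
      using \<rho>(1) \<gamma>(1) B_nonneg by (simp add: powr_mult)
    finally have "(\<Sum>i\<in>UNIV. norm ((A \<otimes>\<^sub>K B) x $ i) powr r) powr (1 / r)
        \<le> ((\<rho> * \<gamma> * onorm B) powr r * X) powr (1 / r)"
      using finite(1) by (intro powr_mono2) (auto simp: sum_nonneg)
    also have "\<dots> = \<rho> * \<gamma> * onorm B * X powr (1 / r)"
      using finite(1) \<rho>(1) \<gamma>(1) B_nonneg X by (simp add: powr_mult powr_powr)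
    finally show ?thesis
      using finite(1) unfolding finite(3,4) \<rho>_def [symmetric] \<gamma>_def [symmetric]
      by (simp add: finite(2) lp_norm_ennreal X_def)
  qed
qed

text \<open>
  The quotients are bounded by the Schur test, so the supremum defining \<open>lp_opnorm\<close> is meaningful.
\<close>
lemma lp_norm_ratio_le_lp_opnorm:
  fixes A :: "complex ^ 'n ^ 'n" and B :: "'h::complex_inner \<Rightarrow> 'h"
  assumes "bounded_clinear B" "1 \<le> p" "1 / p + 1 / q = 1" "x \<noteq> 0"
  shows "lp_norm p ((A \<otimes>\<^sub>K B) x) / lp_norm p x \<le> lp_opnorm p (A \<otimes>\<^sub>K B)"
  unfolding lp_opnorm_def
proof (rule cSUP_upper)
  show "bdd_above ((\<lambda>x. lp_norm p ((A \<otimes>\<^sub>K B) x) / lp_norm p x) ` {x. x \<noteq> 0})"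
    by (rule bdd_aboveI2, subst pos_divide_le_eq)
      (use lp_norm_kronecker_le [OF assms(1-3), of A] lp_norm_pos [OF assms(2)] in auto)
qed (use assms(4) in simp)

lemma lp_norm_mono:
  fixes x y :: "'h::real_normed_vector ^ 'n"
  assumes "1 \<le> p" "0 \<le> s" "\<And>i. s * norm (x $ i) \<le> norm (y $ i)"
  shows "s * lp_norm p x \<le> lp_norm p y"
proof (cases p)
  case top
  obtain j where j: "lp_norm top x = norm (x $ j)"
  proof -
    have "lp_norm top x \<in> range (\<lambda>j. norm (x $ j))"
      unfolding lp_norm_top by (rule Max_in) auto
    then show ?thesis
      using that by blast
  qed
  have "s * norm (x $ j) \<le> lp_norm top y"
    unfolding lp_norm_top by (rule order_trans [OF assms(3)]) (rule Max_ge, auto)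
  then show ?thesis
    by (simp add: top j)
next
  case (real r)
  have r: "1 \<le> r"
    using assms(1) real by (simp add: ennreal_ge_1)
  have "s * lp_norm p x = (\<Sum>j\<in>UNIV. (s * norm (x $ j)) powr r) powr (1 / r)"
    using real r assms(2)
    by (simp add: lp_norm_ennreal powr_mult sum_distrib_left [symmetric] sum_nonneg powr_powr)
  also have "\<dots> \<le> lp_norm p y"
    unfolding real(2) lp_norm_ennreal [OF real(1)] using r assms(2,3)
    by (intro powr_mono2 sum_mono) (auto intro: sum_nonneg)
  finally show ?thesis .
qed

text \<open>
  The components of \<open>(A \<otimes> B) (h, \<dots>, h)\<close> are the row sums of \<open>A\<close> times \<open>B h\<close>, so each has norm
  at least \<open>m \<parallel>B h\<parallel> / \<parallel>h\<parallel>\<close> times that of the corresponding component \<open>h\<close>, and monotonicity of the \<open>\<ell>\<^sub>p\<close> norm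
  carries the factor over.
\<close>
lemma lp_opnorm_kronecker_ge:
  fixes A :: "complex ^ 'n ^ 'n" and B :: "'h::complex_inner \<Rightarrow> 'h"
  assumes ex: "\<exists>x::'h. x \<noteq> 0" and B: "bounded_clinear B" and pq: "1 \<le> p" "1 / p + 1 / q = 1"
  shows "(MIN i. cmod (\<Sum>j\<in>UNIV. A $ i $ j)) * onorm B \<le> lp_opnorm p (A \<otimes>\<^sub>K B)"
proof -
  define m where "m = (MIN i. cmod (\<Sum>j\<in>UNIV. A $ i $ j))"
  define L where "L = lp_opnorm p (A \<otimes>\<^sub>K B)"
  have m_le: "m \<le> cmod (\<Sum>j\<in>UNIV. A $ i $ j)" for i
    unfolding m_def by (rule Min_le) auto
  have m_nonneg: "0 \<le> m"
    unfolding m_def by (rule Min.boundedI) auto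
  have ratio: "m * norm (B h) \<le> L * norm h" if "h \<noteq> 0" for h
  proof -
    define v :: "'h ^ 'n" where "v = (\<chi> i. h)"
    have v: "v \<noteq> 0"
      using that by (simp add: v_def vec_eq_iff)
    have "m * norm (B h) / norm h * lp_norm p v \<le> lp_norm p ((A \<otimes>\<^sub>K B) v)"
      by (rule lp_norm_mono [OF pq(1)])
        (use that m_nonneg m_le in \<open>auto simp: v_def kronecker_def scaleC_sum_left [symmetric] norm_scaleC
          mult_right_mono\<close>)
    then have "m * norm (B h) / norm h \<le> lp_norm p ((A \<otimes>\<^sub>K B) v) / lp_norm p v"
      using lp_norm_pos [OF pq(1) v] by (simp add: pos_le_divide_eq)
    also have "\<dots> \<le> L"
      unfolding L_def by (rule lp_norm_ratio_le_lp_opnorm [OF B pq v])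
    finally show ?thesis
      using that by (simp add: pos_divide_le_eq)
  qed
  have L_nonneg: "0 \<le> L"
  proof -
    obtain h :: 'h where h: "norm h = 1"
      using exists_norm_one [OF ex] by blast
    then have "0 \<le> m * norm (B h)" "h \<noteq> 0"
      using m_nonneg by auto
    with ratio [of h] h show ?thesis
      by simp
  qed
  have B0: "B 0 = 0"
    using bounded_clinear_sum [OF B, of _ "{}"] by simp
  have "m * onorm B \<le> L"
  proof (cases "m = 0")
    case False
    then have m: "0 < m"
      using m_nonneg by simp
    have "onorm B \<le> L / m"
    proof (rule onorm_bound)
      show "norm (B h) \<le> L / m * norm h" for h
        using ratio [of h] m by (cases "h = 0") (simp_all add: B0 field_simps)
    qed (use L_nonneg m in simp)
    then show ?thesis
      using m by (simp add: field_simps)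
  qed (simp add: L_nonneg)
  then show ?thesis
    by (simp add: m_def L_def)
qed

lemma lp_opnorm_kronecker_le:
  fixes A :: "complex ^ 'n ^ 'n" and B :: "'h::complex_inner \<Rightarrow> 'h"
  assumes ex: "\<exists>x::'h. x \<noteq> 0" and B: "bounded_clinear B" and pq: "1 \<le> p" "1 / p + 1 / q = 1"
  shows "lp_opnorm p (A \<otimes>\<^sub>K B)
    \<le> rpow (MAX i. \<Sum>j\<in>UNIV. cmod (A $ i $ j)) (enn2real (1 / q))
      * rpow (MAX j. \<Sum>i\<in>UNIV. cmod (A $ i $ j)) (enn2real (1 / p)) * onorm B"
  unfolding lp_opnorm_def
proof (rule cSUP_least)
  obtain h :: 'h where "h \<noteq> 0"
    using ex by blast
  then have "(\<chi> i. h) \<noteq> (0 :: 'h ^ 'n)"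
    by (simp add: vec_eq_iff)
  then show "{x :: 'h ^ 'n. x \<noteq> 0} \<noteq> {}"
    by blast
next
  fix x :: "'h ^ 'n"
  assume "x \<in> {x. x \<noteq> 0}"
  then show "lp_norm p ((A \<otimes>\<^sub>K B) x) / lp_norm p x
    \<le> rpow (MAX i. \<Sum>j\<in>UNIV. cmod (A $ i $ j)) (enn2real (1 / q))
      * rpow (MAX j. \<Sum>i\<in>UNIV. cmod (A $ i $ j)) (enn2real (1 / p)) * onorm B"
    using lp_norm_kronecker_le [OF B pq, of A x] lp_norm_pos [OF pq(1), of x]
    by (simp add: pos_divide_le_eq)
qed

section \<open>Bounds for Kronecker products\<close>

theorem theorem1p7:
  fixes A :: "complex ^ 'n ^ 'n" and B :: "'h::chilbert_space \<Rightarrow> 'h"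
  assumes "\<exists>x::'h. x \<noteq> 0"
    and "bounded_clinear B"
  shows "numerical_radius ((*v) A) * numerical_radius B \<le> numerical_radius (A \<otimes>\<^sub>K B)
      \<and> numerical_radius (A \<otimes>\<^sub>K B) \<le> onorm ((*v) A) * numerical_radius B
      \<and> onorm ((*v) A) * numerical_radius B
          \<le> sqrt (MAX i. \<Sum>j\<in>UNIV. cmod (A $ i $ j))
            * sqrt (MAX j. \<Sum>i\<in>UNIV. cmod (A $ i $ j)) * numerical_radius B
      \<and> (\<forall>p q :: ennreal. 1 \<le> p \<longrightarrow> 1 / p + 1 / q = 1 \<longrightarrow>
          (MIN i. cmod (\<Sum>j\<in>UNIV. A $ i $ j)) * onorm B \<le> lp_opnorm p (A \<otimes>\<^sub>K B)
          \<and> lp_opnorm p (A \<otimes>\<^sub>K B)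
              \<le> rpow (MAX i. \<Sum>j\<in>UNIV. cmod (A $ i $ j)) (enn2real (1 / q))
                * rpow (MAX j. \<Sum>i\<in>UNIV. cmod (A $ i $ j)) (enn2real (1 / p)) * onorm B)"
  using numerical_radius_kronecker_ge [OF assms] numerical_radius_kronecker_le [OF assms]
    mult_right_mono [OF onorm_le_Schur numerical_radius_nonneg [OF assms]]
    lp_opnorm_kronecker_ge [OF assms] lp_opnorm_kronecker_le [OF assms]
  by blast

end
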